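(* Let $\mu\in\mathcal M(\mathbb R^{d-1})$ and let $\mu(d\bar x)=f(\bar x)\omega_\alpha(d\bar x)+\nu(d\bar x)$ be the Lebesgue decomposition of $\mu$ with respect to $\omega_\alpha$. Then $M_{\mathbb H}[\mu]$ has the nontangential limit $f(\bar y)$ at almost every $y=(\bar y,0)\in\mathbf L$ with respect to $(d-1)$-dimensional Lebesgue measure.
   Context: Let $d\ge2$, $\alpha\in(1,2)$. Write $x=(\bar x,x_d)\in\mathbb R^{d-1}\times\mathbb R$, $\mathbf L=\{x\in\mathbb R^d:x_d=0\}$ (identified with $\mathbb R^{d-1}$), $\mathbb H=\mathbb R^d\setminus\mathbf L$, $e_d=(0,\dots,0,1)$. $\mathcal M(\mathbb R^{d-1})$ is the space of finite signed Borel measures on $\mathbb R^{d-1}$. Let $\mathcal C_3=\pi^{(1-d)/2}\Gamma((\alpha+d)/2-1)/\Gamma((\alpha-1)/2)$ and $\omega_\alpha(d\bar x)=\mathcal C_3|e_d-(\bar x,0)|^{-(d+\alpha-2)}d\bar x$ (a probability measure on $\mathbb R^{d-1}$). Let $M_{\mathbb H}(x,\bar y)=\frac{|x_d|^{\alpha-1}|e_d-(\bar y,0)|^{d+\alpha-2}}{|x-(\bar y,0)|^{d+\alpha-2}}$ for $x\in\mathbb H,\bar y\in\mathbb R^{d-1}$, and $M_{\mathbb H}[\mu](x)=\int_{\mathbb R^{d-1}}M_{\mathbb H}(x,\bar y)\mu(d\bar y)$. For $y\in\mathbf L$ and $\beta>0$ let $\Gamma_\beta(y)=\{x\in\mathbb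 H:|x-y|<(1+\beta)|x_d|\}$; a function $u$ on $\mathbb H$ has nontangential limit $L$ at $y$ if for every $\beta>0$, $\lim_{\Gamma_\beta(y)\ni x\to y}u(x)=L$. *)

theory Defs
  imports "HOL-Analysis.Analysis"
begin

text \<open>Conventions. \<open>R^{d-1}\<close> is modelled by a Euclidean space type \<open>'a\<close>;
  \<open>R^d\<close> is \<open>'a \<times> real\<close>, a point \<open>x = (xbar, x_d)\<close>.  Thus \<open>d = DIM('a) + 1 \<ge> 2\<close>.
  The Euclidean norm on \<open>'a \<times> real\<close> is the product (Euclidean) norm.\<close>

definition dimd :: "'a::euclidean_space itself \<Rightarrow> real" where
  "dimd _ = real DIM('a) + 1"

definition ed :: "'a::euclidean_space \<times> real" where
  "ed = (0, 1)"

definition C3 :: "'a::euclidean_space itself \<Rightarrow> real \<Rightarrow> real" where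
  "C3 T \<alpha> = pi powr ((1 - dimd T) / 2) * Gamma ((\<alpha> + dimd T) / 2 - 1) / Gamma ((\<alpha> - 1) / 2)"

definition omega_alpha :: "real \<Rightarrow> 'a::euclidean_space measure" where
  "omega_alpha \<alpha> = density lborel
     (\<lambda>xb. ennreal (C3 TYPE('a) \<alpha> * norm (ed - (xb, 0)) powr (- (dimd TYPE('a) + \<alpha> - 2))))"

definition MH :: "real \<Rightarrow> 'a::euclidean_space \<times> real \<Rightarrow> 'a \<Rightarrow> real" where
  "MH \<alpha> x yb = \<bar>snd x\<bar> powr (\<alpha> - 1) * norm (ed - (yb, 0)) powr (dimd TYPE('a) + \<alpha> - 2)
                 / norm (x - (yb, 0)) powr (dimd TYPE('a) + \<alpha> - 2)"

text \<open>A finite signed Borel measure \<open>\<mu>\<close> is given as \<open>\<mu> = \<mu>p - \<mu>n\<close> with \<open>\<mu>p, \<mu>n\<close>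
  finite Borel measures; \<open>M_H[\<mu>]\<close> is then the difference of the two integrals.\<close>
definition finite_borel :: "'a::euclidean_space measure \<Rightarrow> bool" where
  "finite_borel m \<longleftrightarrow> sets m = sets borel \<and> finite_measure m"

definition MH_meas :: "real \<Rightarrow> 'a::euclidean_space measure \<Rightarrow> 'a measure \<Rightarrow> 'a \<times> real \<Rightarrow> real" where
  "MH_meas \<alpha> \<mu>p \<mu>n x = (\<integral>yb. MH \<alpha> x yb \<partial>\<mu>p) - (\<integral>yb. MH \<alpha> x yb \<partial>\<mu>n)"

definition HH :: "('a::euclidean_space \<times> real) set" where
  "HH = {x. snd x \<noteq> 0}"

definition cone :: "real \<Rightarrow> 'a::euclidean_space \<times> real \<Rightarrow> ('a \<times> real) set" where
  "cone \<beta> y = {x \<in> HH. norm (x - y) < (1 + \<beta>) * \<bar>snd x\<bar>}"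

definition nontangential_limit ::
  "('a::euclidean_space \<times> real \<Rightarrow> real) \<Rightarrow> 'a \<Rightarrow> real \<Rightarrow> bool" where
  "nontangential_limit u yb L \<longleftrightarrow>
     (\<forall>\<beta>>0. (u \<longlongrightarrow> L) (at (yb, 0) within cone \<beta> (yb, 0)))"

end

theory Submission
  imports Defs "HOL-Probability.Distributions"
begin

text \<open>
  The key fact: if a finite measure \<open>m\<close> vanishes on a Borel set \<open>A\<close>, then its kernel integral has
  nontangential limit 0 at Lebesgue-almost every point of \<open>A\<close>. Indeed, outer regularity and Vitali's
  covering lemma show that \<open>m\<close> has density 0 at almost every point of \<open>A\<close>, and in a cone the kernel is
  dominated by a geometrically decaying sum over dyadic balls around the vertex plus a term of order
  \<open>\<bar>x_d\<bar> powr (\<alpha> - 1)\<close>. This settles the singular part at once. For \<open>f \<omega>\<close> it is applied to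
  \<open>(f - q)\<^sup>+ \<omega>\<close> and \<open>(q - f)\<^sup>+ \<omega>\<close> with \<open>q\<close> rational, which replaces both the maximal function and the
  approximation by continuous functions; the only other input is that the kernel has \<open>\<omega>\<close>-mass one.
\<close>

subsection \<open>The normalising constant\<close>

lemma nn_integral_gaussian:
  fixes u m :: real
  assumes "u > 0"
  shows "(\<integral>\<^sup>+x. ennreal (exp (- (u * (x - m)\<^sup>2))) \<partial>lborel) = ennreal (sqrt (pi / u))"
proof -
  \<comment> \<open>The standard deviation for which the normal density with mean \<open>m\<close>
    equals the integrand divided by \<open>sqrt (pi / u)\<close>; the claim is then that this
    density has total mass one.\<close>
  define \<sigma> where "\<sigma> = 1 / sqrt (2 * u)"
  have \<sigma>: "\<sigma> > 0" and \<sigma>2: "\<sigma>\<^sup>2 = 1 / (2 * u)"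
    using assms by (auto simp: \<sigma>_def power_divide)
  interpret prob_space "density lborel (normal_density m \<sigma>)"
    by (rule prob_space_normal_density[OF \<sigma>])
  have "normal_density m \<sigma> x * sqrt (pi / u) = exp (- (u * (x - m)\<^sup>2))" for x
    using assms by (simp add: normal_density_def \<sigma>2 real_sqrt_divide field_simps)
  hence "(\<integral>\<^sup>+x. ennreal (exp (- (u * (x - m)\<^sup>2))) \<partial>lborel)
      = (\<integral>\<^sup>+x. ennreal (normal_density m \<sigma> x) * ennreal (sqrt (pi / u)) \<partial>lborel)"
    using assms \<sigma> by (intro nn_integral_cong) (simp add: ennreal_mult[symmetric])
  also have "\<dots> = ennreal (sqrt (pi / u))"
    using emeasure_space_1 by (simp add: nn_integral_multc emeasure_density)
  finally show ?thesis .
qed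

text \<open>The Gaussian is a product over the coordinates in \<open>Basis\<close>, so the integral
  is a power of the one-dimensional one.\<close>

lemma nn_integral_gaussian_euclidean:
  fixes c :: "'a::euclidean_space"
  assumes "u > 0"
  shows "(\<integral>\<^sup>+y. ennreal (exp (- (u * (norm (y - c))\<^sup>2))) \<partial>lborel)
    = ennreal ((pi / u) powr (real DIM('a) / 2))"
proof -
  have "exp (- (u * (norm (y - c))\<^sup>2)) = (\<Prod>b\<in>Basis. exp (- (u * (y \<bullet> b - c \<bullet> b)\<^sup>2)))" for y
  proof -
    have "(norm (y - c))\<^sup>2 = (\<Sum>b\<in>Basis. (y \<bullet> b - c \<bullet> b)\<^sup>2)"
      unfolding power2_norm_eq_inner euclidean_inner[of "y - c" "y - c"]
      by (simp add: power2_eq_square inner_diff_left)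
    thus ?thesis
      by (simp add: exp_sum[symmetric] sum_negf sum_distrib_left)
  qed
  hence "(\<integral>\<^sup>+y. ennreal (exp (- (u * (norm (y - c))\<^sup>2))) \<partial>lborel)
      = (\<integral>\<^sup>+y. (\<Prod>b\<in>Basis. ennreal (exp (- (u * (y \<bullet> b - c \<bullet> b)\<^sup>2)))) \<partial>lborel)"
    by (simp add: prod_ennreal)
  also have "\<dots> = (\<Prod>b\<in>(Basis::'a set). \<integral>\<^sup>+x. ennreal (exp (- (u * (x - c \<bullet> b)\<^sup>2))) \<partial>lborel)"
    by (rule nn_integral_lborel_prod) auto
  also have "\<dots> = ennreal (sqrt (pi / u) ^ DIM('a))"
    using assms by (simp add: nn_integral_gaussian ennreal_power)
  also have "sqrt (pi / u) ^ DIM('a) = (pi / u) powr (real DIM('a) / 2)"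
    using assms by (simp add: powr_half_sqrt[symmetric] powr_realpow[symmetric] powr_powr)
  finally show ?thesis .
qed

lemma nn_integral_Gamma_scaled:
  fixes a k :: real
  assumes "a > 0" "k > 0"
  shows "(\<integral>\<^sup>+u. ennreal (indicator {0<..} u * (u powr (k - 1) * exp (- (u * a)))) \<partial>lborel)
    = ennreal (Gamma k * a powr (- k))"
proof -
  let ?J = "\<integral>\<^sup>+u. ennreal (indicator {0<..} u * (u powr (k - 1) * exp (- (u * a)))) \<partial>lborel"
  have "ennreal (Gamma k) = (\<integral>\<^sup>+t. ennreal (indicator {0..} t * t powr (k - 1) / exp t) \<partial>lborel)"
    by (rule Gamma_conv_nn_integral_real) fact
  also have "\<dots> = \<bar>a\<bar> * (\<integral>\<^sup>+u. ennreal (indicator {0..} (0 + a * u) * (0 + a * u) powr (k - 1) / exp (0 + a * u)) \<partial>lborel)"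
    using assms by (intro nn_integral_real_affine) auto
  also have "(\<integral>\<^sup>+u. ennreal (indicator {0..} (0 + a * u) * (0 + a * u) powr (k - 1) / exp (0 + a * u)) \<partial>lborel)
     = (\<integral>\<^sup>+u. ennreal (a powr (k - 1)) * ennreal (indicator {0<..} u * (u powr (k - 1) * exp (- (u * a)))) \<partial>lborel)"
    using assms by (intro nn_integral_cong)
      (auto simp: indicator_def zero_le_mult_iff powr_mult exp_minus ennreal_mult[symmetric] field_simps)
  also have "\<dots> = ennreal (a powr (k - 1)) * ?J"
    by (intro nn_integral_cmult) auto
  finally have "ennreal (Gamma k) = ennreal (a powr k) * ?J"
    using assms by (simp add: mult.assoc[symmetric] ennreal_mult[symmetric] powr_diff)
  hence "ennreal (a powr (- k)) * ennreal (Gamma k) = ennreal (a powr (- k)) * ennreal (a powr k) * ?J"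
    by (simp add: mult.assoc)
  thus ?thesis
    using assms by (simp add: ennreal_mult[symmetric] powr_add[symmetric] Gamma_real_nonneg mult.commute)
qed

text \<open>Write the power as a Gamma integral of Gaussians and integrate the Gaussians first.\<close>

lemma nn_integral_Poisson_kernel:
  fixes c :: "'a::euclidean_space" and s t :: real
  assumes "s > 0" "t \<noteq> 0"
  shows "(\<integral>\<^sup>+y. ennreal ((t\<^sup>2 + (norm (y - c))\<^sup>2) powr (- ((DIM('a) + s) / 2))) \<partial>lborel)
    = ennreal (pi powr (DIM('a) / 2) * Gamma (s / 2) / Gamma ((DIM('a) + s) / 2) * \<bar>t\<bar> powr (- s))"
proof -
  define n where "n = real DIM('a)"
  define k where "k = (n + s) / 2"
  have k: "k > 0" using assms by (simp add: k_def n_def add_nonneg_pos)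
  hence Gk: "Gamma k > 0" by (rule Gamma_real_pos)
  have pos: "t\<^sup>2 + (norm (y - c))\<^sup>2 > 0" for y
    using assms by (simp add: add_pos_nonneg)
  let ?I = "\<integral>\<^sup>+y. ennreal ((t\<^sup>2 + (norm (y - c))\<^sup>2) powr (- k)) \<partial>lborel"
  let ?F = "\<lambda>y u. ennreal (indicator {0<..} u * (u powr (k - 1) * exp (- (u * (t\<^sup>2 + (norm (y - c))\<^sup>2)))))"
  \<comment> \<open>The factor \<open>Gamma k\<close> stays on the left until the end, so that the
    extended nonnegative reals need no division.\<close>
  have "ennreal (Gamma k) * ?I
     = (\<integral>\<^sup>+y. ennreal (Gamma k) * ennreal ((t\<^sup>2 + (norm (y - c))\<^sup>2) powr (- k)) \<partial>lborel)"
    by (intro nn_integral_cmult[symmetric]) auto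
  also have "\<dots> = (\<integral>\<^sup>+y. (\<integral>\<^sup>+u. ?F y u \<partial>lborel) \<partial>lborel)"
    using pos Gk k
    by (intro nn_integral_cong) (simp add: nn_integral_Gamma_scaled ennreal_mult[symmetric])
  also have "\<dots> = (\<integral>\<^sup>+u. (\<integral>\<^sup>+y. ?F y u \<partial>lborel) \<partial>lborel)"
    by (rule lborel_pair.Fubini') measurable
  also have "\<dots> = (\<integral>\<^sup>+u. ennreal (pi powr (n / 2)) *
      ennreal (indicator {0<..} u * (u powr (s / 2 - 1) * exp (- (u * t\<^sup>2)))) \<partial>lborel)"
  proof (intro nn_integral_cong)
    fix u :: real
    show "(\<integral>\<^sup>+y. ?F y u \<partial>lborel) = ennreal (pi powr (n / 2)) *
      ennreal (indicator {0<..} u * (u powr (s / 2 - 1) * exp (- (u * t\<^sup>2))))"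
    proof (cases "u > 0")
      case True
      have "(\<integral>\<^sup>+y. ?F y u \<partial>lborel) = (\<integral>\<^sup>+y. ennreal (u powr (k - 1) * exp (- (u * t\<^sup>2))) *
          ennreal (exp (- (u * (norm (y - c))\<^sup>2))) \<partial>lborel)"
        using True by (intro nn_integral_cong) (simp add: ennreal_mult[symmetric] exp_add[symmetric] algebra_simps)
      also have "\<dots> = ennreal (u powr (k - 1) * exp (- (u * t\<^sup>2))) * ennreal ((pi / u) powr (n / 2))"
        using True by (simp add: nn_integral_cmult nn_integral_gaussian_euclidean n_def)
      also have "\<dots> = ennreal (u powr (k - 1) * exp (- (u * t\<^sup>2)) * (pi / u) powr (n / 2))"
        by (simp add: ennreal_mult)
      also have "u powr (k - 1) * exp (- (u * t\<^sup>2)) * (pi / u) powr (n / 2)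
          = pi powr (n / 2) * (u powr (s / 2 - 1) * exp (- (u * t\<^sup>2)))"
      proof -
        \<comment> \<open>The Gaussian integral contributes \<open>u powr (- (n / 2))\<close>, which
          lowers the exponent \<open>k - 1\<close> to \<open>s / 2 - 1\<close> and leaves a Gamma
          integral with parameter \<open>s / 2\<close>.\<close>
        have "s / 2 - 1 = (k - 1) - n / 2" by (simp add: k_def field_simps)
        hence "u powr (s / 2 - 1) = u powr (k - 1) / u powr (n / 2)"
          by (simp only: powr_diff)
        thus ?thesis using True by (simp add: powr_divide)
      qed
      finally show ?thesis using True by (simp add: ennreal_mult)
    qed auto
  qed
  also have "\<dots> = ennreal (pi powr (n / 2)) * ennreal (Gamma (s / 2) * (t\<^sup>2) powr (- (s / 2)))"
    using assms by (simp add: nn_integral_cmult nn_integral_Gamma_scaled)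
  also have "(t\<^sup>2) powr (- (s / 2)) = \<bar>t\<bar> powr (- s)"
    using assms powr_powr[of "\<bar>t\<bar>" 2 "- (s / 2)"] by simp
  also have "ennreal (pi powr (n / 2)) * ennreal (Gamma (s / 2) * \<bar>t\<bar> powr (- s))
      = ennreal (pi powr (n / 2) * Gamma (s / 2) * \<bar>t\<bar> powr (- s))"
    using assms by (simp add: ennreal_mult Gamma_real_nonneg mult.assoc)
  finally have *: "ennreal (Gamma k) * ?I = ennreal (pi powr (n / 2) * Gamma (s / 2) * \<bar>t\<bar> powr (- s))" .
  have "?I = ennreal (1 / Gamma k) * (ennreal (Gamma k) * ?I)"
    using Gk by (simp add: mult.assoc[symmetric] ennreal_mult[symmetric])
  also have "\<dots> = ennreal (pi powr (n / 2) * Gamma (s / 2) / Gamma k * \<bar>t\<bar> powr (- s))"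
    using Gk assms unfolding * by (simp add: ennreal_mult[symmetric] Gamma_real_nonneg)
  finally show ?thesis by (simp add: n_def k_def)
qed

section \<open>The kernel and its mass under \<open>omega_alpha\<close>\<close>

lemma norm_diff_boundary:
  fixes x :: "'a::euclidean_space \<times> real"
  shows "norm (x - (y, 0)) = sqrt ((snd x)\<^sup>2 + (norm (y - fst x))\<^sup>2)"
  by (cases x) (simp add: norm_Pair norm_minus_commute)

lemma borel_measurable_MH [measurable]: "MH \<alpha> x \<in> borel_measurable borel"
  unfolding MH_def norm_diff_boundary by measurable

lemma MH_nonneg: "MH \<alpha> x y \<ge> 0"
  by (simp add: MH_def)

lemma sets_omega_alpha [measurable_cong, simp]: "sets (omega_alpha \<alpha>) = sets borel"
  by (simp add: omega_alpha_def)

lemma C3_nonneg: "\<alpha> > 1 \<Longrightarrow> C3 TYPE('a::euclidean_space) \<alpha> \<ge> 0"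
  by (simp add: C3_def dimd_def Gamma_real_nonneg)

text \<open>The numerator weight of the kernel cancels the density of \<open>omega_alpha\<close>.
  What remains is the integral from \<open>nn_integral_Poisson_kernel\<close> with
  \<open>s = \<alpha> - 1\<close>, whose constant is the reciprocal of \<open>C3\<close>.\<close>

lemma nn_integral_MH_omega_alpha:
  fixes x :: "'a::euclidean_space \<times> real"
  assumes "\<alpha> > 1" "x \<in> HH"
  shows "(\<integral>\<^sup>+y. ennreal (MH \<alpha> x y) \<partial>omega_alpha \<alpha>) = 1"
proof -
  define s where "s = \<alpha> - 1"
  define t where "t = snd x"
  define p where "p = real DIM('a) + s"
  have s: "s > 0" and t: "t \<noteq> 0" using assms by (auto simp: s_def t_def HH_def)
  have p: "dimd TYPE('a) + \<alpha> - 2 = p" by (simp add: dimd_def p_def s_def)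
  have p0: "p > 0" using s by (simp add: p_def add_nonneg_pos)
  have e: "norm (ed - (y, 0)) > 0" for y :: 'a by (simp add: ed_def zero_prod_def)
  have c: "C3 TYPE('a) \<alpha> = 1 / (pi powr (DIM('a) / 2) * Gamma (s / 2) / Gamma (p / 2))"
    by (simp add: C3_def dimd_def p_def s_def powr_minus field_simps)
  have *: "C3 TYPE('a) \<alpha> * norm (ed - (y, 0)) powr (- p) * MH \<alpha> x y
      = (C3 TYPE('a) \<alpha> * \<bar>t\<bar> powr s) * (t\<^sup>2 + (norm (y - fst x))\<^sup>2) powr (- (p / 2))" for y
  proof -
    have "norm (x - (y, 0)) powr p = (t\<^sup>2 + (norm (y - fst x))\<^sup>2) powr (p / 2)"
      using t by (simp add: norm_diff_boundary t_def powr_half_sqrt[symmetric] powr_powr)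
    moreover have "norm (ed - (y, 0)) powr p \<noteq> 0" using e[of y] by simp
    ultimately show ?thesis
      unfolding MH_def p by (simp add: powr_minus s_def t_def field_simps)
  qed
  have "(\<integral>\<^sup>+y. ennreal (MH \<alpha> x y) \<partial>omega_alpha \<alpha>)
     = (\<integral>\<^sup>+y. ennreal (C3 TYPE('a) \<alpha> * norm (ed - (y, 0)) powr (- p)) * ennreal (MH \<alpha> x y) \<partial>lborel)"
    unfolding omega_alpha_def p by (intro nn_integral_density) (auto simp: norm_diff_boundary)
  also have "\<dots> = (\<integral>\<^sup>+y. ennreal (C3 TYPE('a) \<alpha> * \<bar>t\<bar> powr s)
       * ennreal ((t\<^sup>2 + (norm (y - fst x))\<^sup>2) powr (- (p / 2))) \<partial>lborel)"
    using assms * C3_nonneg[of \<alpha>, where 'a='a] MH_nonneg[of \<alpha> x]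
    by (intro nn_integral_cong) (simp add: ennreal_mult[symmetric])
  also have "\<dots> = ennreal (C3 TYPE('a) \<alpha> * \<bar>t\<bar> powr s) *
      ennreal (pi powr (DIM('a) / 2) * Gamma (s / 2) / Gamma (p / 2) * \<bar>t\<bar> powr (- s))"
    using nn_integral_Poisson_kernel[OF s t, of "fst x"] by (simp add: nn_integral_cmult p_def)
  also have "\<dots> = ennreal ((C3 TYPE('a) \<alpha> * \<bar>t\<bar> powr s) *
      (pi powr (DIM('a) / 2) * Gamma (s / 2) / Gamma (p / 2) * \<bar>t\<bar> powr (- s)))"
    using s p0 assms C3_nonneg[of \<alpha>, where 'a='a]
    by (intro ennreal_mult[symmetric]) (auto intro!: mult_nonneg_nonneg divide_nonneg_nonneg Gamma_real_nonneg)
  also have "(C3 TYPE('a) \<alpha> * \<bar>t\<bar> powr s) *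
      (pi powr (DIM('a) / 2) * Gamma (s / 2) / Gamma (p / 2) * \<bar>t\<bar> powr (- s)) = 1"
  proof -
    have "Gamma (s / 2) \<noteq> 0" "Gamma (p / 2) \<noteq> 0"
      using s p0 Gamma_real_pos[of "s / 2"] Gamma_real_pos[of "p / 2"] by linarith+
    thus ?thesis using t unfolding c by (simp add: powr_minus field_simps)
  qed
  finally show ?thesis by simp
qed

text \<open>The kernel with pole \<open>ed\<close> is identically 1, so its integral is the total
  mass of \<open>omega_alpha\<close>.\<close>

lemma prob_space_omega_alpha:
  assumes "\<alpha> > 1"
  shows "prob_space (omega_alpha \<alpha> :: 'a::euclidean_space measure)"
proof
  have "MH \<alpha> ed y = 1" for y :: 'a
    by (simp add: MH_def ed_def zero_prod_def)
  thus "emeasure (omega_alpha \<alpha>) (space (omega_alpha \<alpha> :: 'a measure)) = 1"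
    using nn_integral_MH_omega_alpha[OF assms, of "ed :: 'a \<times> real"] by (simp add: ed_def HH_def)
qed

subsection \<open>Points of zero density\<close>

text \<open>Since \<open>A\<close> is \<open>m\<close>-null, it lies in an open \<open>U\<close> of
  small \<open>m\<close>-mass. Each exceptional point is the centre of a ball inside
  \<open>U\<close> whose mass exceeds \<open>c * r ^ DIM('a)\<close>. Vitali selects disjoint balls
  whose fivefold enlargements cover the exceptional set, and disjointness bounds the volume of the
  enlargements by a multiple of \<open>measure m U\<close>.\<close>

lemma negligible_upper_density_pos:
  fixes m :: "'a::euclidean_space measure"
  assumes m: "finite_borel m" and A: "A \<in> sets borel" "emeasure m A = 0" and c: "c > 0"
  shows "negligible {x \<in> A. \<forall>\<delta>>0. \<exists>r. 0 < r \<and> r < \<delta> \<and> measure m (ball x r) > c * r ^ DIM('a)}"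
    (is "negligible ?E")
  \<comment> \<open>Working with measurable supersets of small measure avoids proving that the
    exceptional set is measurable.\<close>
  unfolding negligible_outer_le
proof (intro allI impI)
  fix e :: real assume e: "e > 0"
  interpret finite_measure m using m by (simp add: finite_borel_def)
  have sets[simp]: "sets m = sets borel" using m by (simp add: finite_borel_def)
  \<comment> \<open>The volume of a ball of radius \<open>5 * r\<close> is
    \<open>v * r ^ DIM('a)\<close>; \<open>\<epsilon>\<close> is then chosen so that
    \<open>v / c * \<epsilon> = e\<close>.\<close>
  define v where "v = unit_ball_vol (real DIM('a)) * 5 ^ DIM('a)"
  have v: "v > 0" by (simp add: v_def)
  define \<epsilon> where "\<epsilon> = e * c / v"
  have \<epsilon>: "\<epsilon> > 0" using e c v by (simp add: \<epsilon>_def)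
  have "(INF U \<in> {U. A \<subseteq> U \<and> open U}. emeasure m U) < ennreal \<epsilon>"
    using outer_regular[of m A] A \<epsilon> emeasure_finite by (simp add: infinity_ennreal_def)
  then obtain U where U: "A \<subseteq> U" "open U" "emeasure m U < ennreal \<epsilon>"
    by (auto simp: INF_less_iff)
  hence mU: "measure m U \<le> \<epsilon>"
    using \<epsilon> by (simp add: emeasure_eq_measure ennreal_less_iff)
  define E where "E = ?E"
  \<comment> \<open>The bound \<open>r \<le> 1\<close> supplies the uniformly bounded radii that
    Vitali's lemma requires.\<close>
  have "\<exists>r. 0 < r \<and> r \<le> 1 \<and> ball x r \<subseteq> U \<and> measure m (ball x r) > c * r ^ DIM('a)" if "x \<in> E" for x
  proof -
    have xE: "x \<in> ?E" using that by (simp add: E_def)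
    obtain d where d: "d > 0" "ball x d \<subseteq> U" using U xE openE[of U x] by blast
    with xE obtain r where "0 < r" "r < min d 1" "measure m (ball x r) > c * r ^ DIM('a)"
      by (auto dest!: spec[of _ "min d 1"])
    moreover from this have "ball x r \<subseteq> ball x d" "r \<le> 1" by (simp_all add: subset_ball)
    ultimately show ?thesis using d by blast
  qed
  then obtain r where r: "\<And>x. x \<in> E \<Longrightarrow> 0 < r x \<and> r x \<le> 1 \<and> ball x (r x) \<subseteq> U
      \<and> measure m (ball x (r x)) > c * r x ^ DIM('a)"
    by metis
  obtain C where C: "countable C" "C \<subseteq> E"
      "pairwise (\<lambda>i j. disjnt (ball i (r i)) (ball j (r j))) C"
      "E \<subseteq> (\<Union>i\<in>C. ball i (5 * r i))"
  proof (rule Vitali_covering_lemma_balls[of E "\<lambda>x. x" r E 1])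
    show "E \<subseteq> (\<Union>i\<in>E. ball i (r i))" using r by force
  qed (use r in auto)
  have meas: "ball i (5 * r i) \<in> lmeasurable" if "i \<in> C" for i
    by simp
  \<comment> \<open>A bound common to all finite subfamilies passes to the countable union.\<close>
  have bound: "measure lebesgue (\<Union>i\<in>I. ball i (5 * r i)) \<le> e" if I: "I \<subseteq> C" "finite I" for I
  proof -
    have "measure lebesgue (\<Union>i\<in>I. ball i (5 * r i)) \<le> (\<Sum>i\<in>I. measure lebesgue (ball i (5 * r i)))"
      using I by (intro measure_UNION_le) auto
    also have "\<dots> = (\<Sum>i\<in>I. v * r i ^ DIM('a))"
    proof (intro sum.cong refl)
      fix i assume "i \<in> I"
      hence "r i > 0" using I C r by blast
      thus "measure lebesgue (ball i (5 * r i)) = v * r i ^ DIM('a)"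
        by (simp add: content_ball power_mult_distrib v_def)
    qed
    also have "\<dots> \<le> (\<Sum>i\<in>I. v / c * measure m (ball i (r i)))"
    proof (intro sum_mono)
      fix i assume "i \<in> I"
      hence "c * r i ^ DIM('a) \<le> measure m (ball i (r i))" using I C r by (meson less_imp_le subsetD)
      hence "v / c * (c * r i ^ DIM('a)) \<le> v / c * measure m (ball i (r i))"
        using v c by (intro mult_left_mono) auto
      thus "v * r i ^ DIM('a) \<le> v / c * measure m (ball i (r i))" using c by simp
    qed
    also have "\<dots> = v / c * (\<Sum>i\<in>I. measure m (ball i (r i)))"
      by (simp add: sum_distrib_left)
    also have "(\<Sum>i\<in>I. measure m (ball i (r i))) = measure m (\<Union>i\<in>I. ball i (r i))"
      using I C(3) by (intro measure_UNION'[symmetric])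
        (auto simp: fmeasurable_eq_sets intro: pairwise_subset)
    finally have le: "measure lebesgue (\<Union>i\<in>I. ball i (5 * r i)) \<le> v / c * measure m (\<Union>i\<in>I. ball i (r i))" .
    have "measure m (\<Union>i\<in>I. ball i (r i)) \<le> measure m U"
    proof (rule finite_measure_mono)
      show "(\<Union>i\<in>I. ball i (r i)) \<subseteq> U"
        using I C(2) r by (intro UN_least) blast
    qed (use U in simp)
    hence "v / c * measure m (\<Union>i\<in>I. ball i (r i)) \<le> v / c * \<epsilon>"
      using mU c v by (intro mult_left_mono) auto
    also have "v / c * \<epsilon> = e" using c v by (simp add: \<epsilon>_def)
    finally show ?thesis using le by simp
  qed
  show "\<exists>T. ?E \<subseteq> T \<and> T \<in> lmeasurable \<and> measure lebesgue T \<le> e"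
    unfolding E_def[symmetric] using C(4) fmeasurable_UN_bound[OF C(1) meas bound] measure_UN_bound[OF C(1) meas bound] by blast
qed

text \<open>Failure of zero density at a point means failure for some threshold
  \<open>inverse (Suc k)\<close>, so the exceptional set is a countable union of negligible
  sets.\<close>

lemma AE_density_zero:
  fixes m :: "'a::euclidean_space measure"
  assumes m: "finite_borel m" and A: "A \<in> sets borel" "emeasure m A = 0"
  shows "AE x in lborel. x \<in> A \<longrightarrow>
    (\<forall>\<epsilon>>0. \<exists>\<delta>>0. \<forall>r. 0 < r \<and> r < \<delta> \<longrightarrow> measure m (ball x r) \<le> \<epsilon> * r ^ DIM('a))"
proof -
  let ?E = "\<lambda>c. {x \<in> A. \<forall>\<delta>>0. \<exists>r. 0 < r \<and> r < \<delta> \<and> measure m (ball x r) > c * r ^ DIM('a)}"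
  have "negligible (\<Union>k::nat. ?E (inverse (Suc k)))"
    by (intro negligible_Union_nat negligible_upper_density_pos[OF m A]) simp
  from AE_not_in[OF this[unfolded negligible_iff_null_sets]]
  have "AE x in lborel. x \<notin> (\<Union>k::nat. ?E (inverse (Suc k)))"
    \<comment> \<open>The union is null for the completed measure \<open>lebesgue\<close>;
      almost-everywhere statements are the same for \<open>lborel\<close>.\<close>
    by (simp only: AE_completion_iff)
  thus ?thesis
  proof eventually_elim
    case (elim x)
    show ?case
    proof (intro impI allI)
      fix \<epsilon> :: real assume x: "x \<in> A" and "\<epsilon> > 0"
      then obtain k where k: "inverse (real (Suc k)) < \<epsilon>" using reals_Archimedean by blast
      obtain \<delta> where "\<delta> > 0" and *: "\<And>r. 0 < r \<Longrightarrow> r < \<delta> \<Longrightarrow> measure m (ball x r) \<le> inverse (Suc k) * r ^ DIM('a)"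
        using elim x by (force simp: not_less)
      moreover have "inverse (Suc k) * r ^ DIM('a) \<le> \<epsilon> * r ^ DIM('a)" if "r > 0" for r
        using k that by (intro mult_right_mono) auto
      ultimately show "\<exists>\<delta>>0. \<forall>r. 0 < r \<and> r < \<delta> \<longrightarrow> measure m (ball x r) \<le> \<epsilon> * r ^ DIM('a)"
        by (meson order_trans)
    qed
  qed
qed

subsection \<open>Kernel estimates in a cone\<close>

text \<open>Collecting the two norms into one ratio reduces every later kernel bound to a bound on
  that ratio.\<close>

lemma MH_eq:
  fixes x :: "'a::euclidean_space \<times> real"
  shows "MH \<alpha> x y = \<bar>snd x\<bar> powr (\<alpha> - 1) * (norm (ed - (y, 0)) / norm (x - (y, 0))) powr (real DIM('a) + \<alpha> - 1)"
  by (simp add: MH_def dimd_def powr_divide algebra_simps)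

lemma abs_snd_le_norm_diff_boundary:
  fixes x :: "'a::euclidean_space \<times> real"
  shows "\<bar>snd x\<bar> \<le> norm (x - (y, 0))"
  by (simp add: norm_diff_boundary real_le_rsqrt)

text \<open>For fixed \<open>x\<close> off the boundary the kernel is bounded in \<open>y\<close>:
  pass from \<open>ed\<close> to \<open>(y, 0)\<close> through \<open>x\<close> and use that
  \<open>norm (x - (y, 0))\<close> is at least \<open>\<bar>snd x\<bar>\<close>.\<close>

lemma integrable_MH:
  fixes x :: "'a::euclidean_space \<times> real"
  assumes "\<alpha> > 1" "x \<in> HH" "finite_borel m"
  shows "integrable m (MH \<alpha> x)"
proof -
  interpret finite_measure m using assms by (simp add: finite_borel_def)
  have [measurable_cong]: "sets m = sets borel" using assms by (simp add: finite_borel_def)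
  define K where "K = norm (ed - x) / \<bar>snd x\<bar> + 1"
  have t: "\<bar>snd x\<bar> > 0" using assms by (simp add: HH_def)
  have "norm (ed - (y, 0)) / norm (x - (y, 0)) \<le> K" for y
  proof -
    have R: "\<bar>snd x\<bar> \<le> norm (x - (y, 0))" by (rule abs_snd_le_norm_diff_boundary)
    have "norm (ed - (y, 0)) \<le> norm (ed - x) + norm (x - (y, 0))"
      using norm_triangle_ineq[of "ed - x" "x - (y, 0)"] by (simp only: diff_add_cancel add_diff_eq)
    also have "norm (ed - x) = norm (ed - x) / \<bar>snd x\<bar> * \<bar>snd x\<bar>" using t by simp
    also have "\<dots> \<le> norm (ed - x) / \<bar>snd x\<bar> * norm (x - (y, 0))"
      by (intro mult_left_mono R) auto
    finally have "norm (ed - (y, 0)) \<le> K * norm (x - (y, 0))" by (simp add: K_def distrib_right)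
    thus ?thesis using less_le_trans[OF t R] by (subst pos_divide_le_eq)
  qed
  hence "MH \<alpha> x y \<le> \<bar>snd x\<bar> powr (\<alpha> - 1) * K powr (real DIM('a) + \<alpha> - 1)" for y
    unfolding MH_eq using assms by (intro mult_left_mono powr_mono2) auto
  thus ?thesis
    by (intro integrable_const_bound[where B = "\<bar>snd x\<bar> powr (\<alpha> - 1) * K powr (real DIM('a) + \<alpha> - 1)"])
      (auto simp: MH_nonneg)
qed

text \<open>Take the least admissible \<open>k\<close>. If \<open>k > 0\<close>, minimality gives
  the bound by \<open>2 * \<rho>\<close>; if \<open>k = 0\<close>, the radius is \<open>t\<close>
  itself, whence the maximum.\<close>

lemma dyadic_scale:
  fixes t \<rho> :: real
  assumes "t > 0"
  obtains k :: nat where "\<rho> < 2 ^ k * t" "2 ^ k * t \<le> 2 * max t \<rho>"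
proof -
  have ex: "\<exists>k::nat. \<rho> < 2 ^ k * t"
    using real_arch_pow[of 2 "\<rho> / t"] assms by (auto simp: field_simps)
  define k where "k = (LEAST k::nat. \<rho> < 2 ^ k * t)"
  have k: "\<rho> < 2 ^ k * t" unfolding k_def by (rule LeastI_ex[OF ex])
  moreover have "2 ^ k * t \<le> 2 * max t \<rho>"
  proof (cases k)
    case 0
    thus ?thesis using assms by simp
  next
    case (Suc j)
    hence "\<not> \<rho> < 2 ^ j * t" unfolding k_def by (metis lessI not_less_Least)
    thus ?thesis using Suc by simp
  qed
  ultimately show ?thesis by (rule that)
qed

text \<open>For \<open>y\<close> at distance at least \<open>\<delta>\<close> from the vertex the
  first term alone suffices. For nearer \<open>y\<close> a single summand suffices, the one whose
  radius \<open>2 ^ k * t\<close> is comparable to the larger of \<open>t\<close> and the distance;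
  summing over all \<open>k\<close> removes the dependence of \<open>k\<close> on \<open>y\<close>.
  The minimum with \<open>\<delta>\<close> keeps the balls at scales where a density bound will be
  available.\<close>

lemma MH_le_dyadic_sum:
  fixes x :: "'a::euclidean_space \<times> real"
  assumes \<alpha>: "\<alpha> > 1" and \<beta>: "\<beta> > 0" and x: "x \<in> cone \<beta> (y0, 0)" and \<delta>: "0 < \<delta>" "\<delta> \<le> 1"
  defines "p \<equiv> real DIM('a) + \<alpha> - 1" and "t \<equiv> \<bar>snd x\<bar>" and "K \<equiv> (2 + norm y0) * (2 + \<beta>)"
  shows "ennreal (MH \<alpha> x y) \<le> ennreal (t powr (\<alpha> - 1) * (K / \<delta>) powr p)
    + (\<Sum>k. ennreal (t powr (\<alpha> - 1) * (2 * K / (2 ^ k * t)) powr p) * indicator (ball y0 (min \<delta> (2 ^ k * t))) y)"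
    (is "_ \<le> ?far + (\<Sum>k. ?near k)")
proof -
  define \<rho> where "\<rho> = dist y0 y"
  define R where "R = norm (x - (y, 0))"
  define E where "E = norm (ed - (y, 0))"
  have p: "p > 0" using \<alpha> by (simp add: p_def)
  have t: "t > 0" and cone: "norm (x - (y0, 0)) < (1 + \<beta>) * t"
    using x by (auto simp: cone_def HH_def t_def)
  have Rt: "t \<le> R" unfolding t_def R_def by (rule abs_snd_le_norm_diff_boundary)
  \<comment> \<open>The cone condition enters here: \<open>R\<close> controls both the distance
    \<open>\<rho>\<close> and the height \<open>t\<close>, each up to the factor
    \<open>2 + \<beta>\<close>.\<close>
  have "\<rho> \<le> norm (x - (y0, 0)) + R"
  proof -
    have "\<rho> = norm ((x - (y, 0)) - (x - (y0, 0)))"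
      by (simp add: \<rho>_def dist_norm norm_Pair norm_minus_commute)
    also have "\<dots> \<le> R + norm (x - (y0, 0))" unfolding R_def by (rule norm_triangle_ineq4)
    finally show ?thesis by simp
  qed
  also have "\<dots> \<le> (1 + \<beta>) * R + R"
    using cone Rt \<beta> by (intro add_mono) (auto intro: order_trans[OF less_imp_le] mult_left_mono)
  finally have \<rho>R: "\<rho> \<le> (2 + \<beta>) * R" by (simp add: algebra_simps)
  have R0: "R > 0" using t Rt by simp
  have tR: "t \<le> (2 + \<beta>) * R" using Rt R0 \<beta> mult_mono[of 1 "2 + \<beta>" t R] t by simp
  have E: "E \<le> 1 + norm y0 + \<rho>"
  proof -
    have "E \<le> norm y + 1"
      unfolding E_def ed_def using norm_Pair_le[of "- y" "1::real"] by simp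
    also have "norm y \<le> norm y0 + \<rho>"
      unfolding \<rho>_def by (metis dist_commute dist_norm norm_triangle_sub)
    finally show ?thesis by simp
  qed
  have MH: "MH \<alpha> x y = t powr (\<alpha> - 1) * (E / R) powr p"
    by (simp add: MH_eq E_def R_def t_def p_def)
  have ER: "E / R \<ge> 0" using R0 by (simp add: E_def)
  show ?thesis
  proof (cases "\<rho> < \<delta>")
    case False
    \<comment> \<open>Both \<open>\<rho> / \<delta>\<close> and \<open>1 / \<delta>\<close> are at
      least 1, which makes the bound on \<open>E\<close> proportional to \<open>\<rho>\<close> and
      hence to \<open>R\<close>.\<close>
    have "E \<le> (1 + norm y0) * 1 + \<rho> * 1" using E by simp
    also have "\<dots> \<le> (1 + norm y0) * (\<rho> / \<delta>) + \<rho> * (1 / \<delta>)"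
      using False \<delta> by (intro add_mono mult_left_mono) auto
    also have "\<dots> = (2 + norm y0) / \<delta> * \<rho>" using \<delta> by (simp add: field_simps)
    also have "\<dots> \<le> (2 + norm y0) / \<delta> * ((2 + \<beta>) * R)"
      using \<delta> \<rho>R by (intro mult_left_mono) auto
    finally have "E / R \<le> K / \<delta>" using R0 by (simp add: K_def field_simps)
    hence "MH \<alpha> x y \<le> t powr (\<alpha> - 1) * (K / \<delta>) powr p"
      unfolding MH using ER p by (intro mult_left_mono powr_mono2) auto
    hence "ennreal (MH \<alpha> x y) \<le> ?far" by (rule ennreal_leI)
    thus ?thesis by (intro add_increasing2) auto
  next
    case True
    obtain k :: nat where k: "\<rho> < 2 ^ k * t" "2 ^ k * t \<le> 2 * max t \<rho>" by (rule dyadic_scale[OF t])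
    \<comment> \<open>The loss of 2 from rounding to a dyadic scale is the 2 in
      \<open>2 * K\<close>.\<close>
    have "2 ^ k * t \<le> 2 * ((2 + \<beta>) * R)" using k tR \<rho>R by linarith
    moreover have "E \<le> 2 + norm y0" using E True \<delta> by simp
    ultimately have "E * (2 ^ k * t) \<le> (2 + norm y0) * (2 * ((2 + \<beta>) * R))"
      using t by (intro mult_mono[of E "2 + norm y0"]) auto
    hence "E / R \<le> 2 * K / (2 ^ k * t)" using R0 t by (simp add: K_def field_simps)
    hence "MH \<alpha> x y \<le> t powr (\<alpha> - 1) * (2 * K / (2 ^ k * t)) powr p"
      unfolding MH using ER p by (intro mult_left_mono powr_mono2) auto
    hence "ennreal (MH \<alpha> x y) \<le> ?near k"
      using True k by (simp add: \<rho>_def ennreal_leI)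
    also have "\<dots> \<le> (\<Sum>k. ?near k)"
      using sum_le_suminf[of ?near "{k}", OF summableI] by (simp only: sum.insert sum.empty finite.intros empty_iff simp_thms) simp
    finally show ?thesis by (intro add_increasing) auto
  qed
qed

text \<open>Integrate the dyadic bound term by term. At radius \<open>r = 2 ^ k * t\<close> the mass
  is at most \<open>\<epsilon> * r ^ DIM('a)\<close> and the kernel factor is
  \<open>t powr (\<alpha> - 1) * (2 * K / r) powr p\<close>. Their product no longer depends on
  \<open>t\<close> and decays like \<open>2 powr (1 - \<alpha>)\<close> to the power
  \<open>k\<close>, so the series is geometric.\<close>

lemma MH_integral_le:
  fixes x :: "'a::euclidean_space \<times> real"
  assumes \<alpha>: "\<alpha> > 1" and \<beta>: "\<beta> > 0" and x: "x \<in> cone \<beta> (y0, 0)" and \<delta>: "0 < \<delta>" "\<delta> \<le> 1"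
    and m: "finite_borel m" and \<epsilon>: "\<epsilon> > 0"
    and dens: "\<And>r. 0 < r \<Longrightarrow> r \<le> \<delta> \<Longrightarrow> measure m (ball y0 r) \<le> \<epsilon> * r ^ DIM('a)"
  defines "p \<equiv> real DIM('a) + \<alpha> - 1" and "t \<equiv> \<bar>snd x\<bar>" and "K \<equiv> (2 + norm y0) * (2 + \<beta>)"
  shows "(\<integral>y. MH \<alpha> x y \<partial>m) \<le> t powr (\<alpha> - 1) * (K / \<delta>) powr p * measure m UNIV
    + \<epsilon> * (2 * K) powr p / (1 - 2 powr (1 - \<alpha>))"
proof -
  interpret finite_measure m using m by (simp add: finite_borel_def)
  have sets[measurable_cong]: "sets m = sets borel" using m by (simp add: finite_borel_def)
  have sp: "space m = UNIV" using sets_eq_imp_space_eq[OF sets] by simp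
  have t: "t > 0" using x by (auto simp: cone_def HH_def t_def)
  have K: "K > 0" using \<beta> by (simp add: K_def add_pos_nonneg)
  define q where "q = 2 powr (1 - \<alpha>)"
  have q: "0 < q" "q < 1" using \<alpha> by (auto simp: q_def powr_less_one)
  let ?far = "t powr (\<alpha> - 1) * (K / \<delta>) powr p"
  define c where "c k = t powr (\<alpha> - 1) * (2 * K / (2 ^ k * t)) powr p" for k :: nat
  define B where "B k = ball y0 (min \<delta> (2 ^ k * t))" for k :: nat
  have B[measurable]: "B k \<in> sets m" for k by (simp add: B_def sets)
  have "(\<integral>\<^sup>+y. ennreal (MH \<alpha> x y) \<partial>m) \<le> (\<integral>\<^sup>+y. (ennreal ?far + (\<Sum>k. ennreal (c k) * indicator (B k) y)) \<partial>m)"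
    by (rule nn_integral_mono) (rule MH_le_dyadic_sum[OF \<alpha> \<beta> x \<delta>, folded p_def t_def K_def, folded c_def B_def])
  also have "\<dots> = (\<integral>\<^sup>+y. ennreal ?far \<partial>m) + (\<integral>\<^sup>+y. (\<Sum>k. ennreal (c k) * indicator (B k) y) \<partial>m)"
    by (rule nn_integral_add) measurable
  also have "\<dots> = ennreal ?far * emeasure m UNIV + (\<Sum>k. ennreal (c k) * emeasure m (B k))"
  proof (intro arg_cong2[where f = "(+)"])
    show "(\<integral>\<^sup>+y. ennreal ?far \<partial>m) = ennreal ?far * emeasure m UNIV"
      by (simp only: nn_integral_const sp)
    have "(\<integral>\<^sup>+y. (\<Sum>k. ennreal (c k) * indicator (B k) y) \<partial>m)
        = (\<Sum>k. \<integral>\<^sup>+y. ennreal (c k) * indicator (B k) y \<partial>m)"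
      by (rule nn_integral_suminf) measurable
    also have "\<dots> = (\<Sum>k. ennreal (c k) * emeasure m (B k))"
      by (intro suminf_cong nn_integral_cmult_indicator B)
    finally show "(\<integral>\<^sup>+y. (\<Sum>k. ennreal (c k) * indicator (B k) y) \<partial>m)
        = (\<Sum>k. ennreal (c k) * emeasure m (B k))" .
  qed
  also have "(\<Sum>k. ennreal (c k) * emeasure m (B k)) \<le> (\<Sum>k. ennreal (\<epsilon> * (2 * K) powr p * q ^ k))"
  proof (intro suminf_le summableI)
    fix k :: nat
    let ?r = "2 ^ k * t"
    have r: "?r > 0" using t by simp
    \<comment> \<open>The truncated radius is at most \<open>\<delta>\<close>, so
      \<open>dens\<close> applies; afterwards the radius is enlarged to \<open>2 ^ k * t\<close> to
      obtain the exact geometric term.\<close>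
    have "measure m (B k) \<le> \<epsilon> * (min \<delta> ?r) ^ DIM('a)" unfolding B_def using \<delta> r by (intro dens) auto
    also have "\<dots> \<le> \<epsilon> * ?r ^ DIM('a)" using \<epsilon> \<delta> r by (intro mult_left_mono power_mono) auto
    finally have "c k * measure m (B k) \<le> c k * (\<epsilon> * ?r ^ DIM('a))"
      by (intro mult_left_mono) (auto simp: c_def)
    also have "\<dots> = \<epsilon> * (2 * K) powr p * q ^ k"
    proof -
      have "(2 * K / ?r) powr p = (2 * K) powr p / ?r powr p"
        using K r by (simp add: powr_divide)
      moreover have "?r powr p = ?r ^ DIM('a) * ?r powr (\<alpha> - 1)"
        using r by (simp add: p_def powr_realpow[symmetric] powr_add[symmetric] algebra_simps del: power_mult_distrib)
      \<comment> \<open>The factor \<open>t powr (\<alpha> - 1)\<close> here cancels the one in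
        \<open>c k\<close>, leaving \<open>q ^ k\<close>.\<close>
      moreover have "?r powr (\<alpha> - 1) = t powr (\<alpha> - 1) / q ^ k"
      proof -
        have "q ^ k = (2 ^ k) powr (1 - \<alpha>)"
          by (simp add: q_def powr_realpow[symmetric] powr_powr mult.commute)
        also have "\<dots> = 1 / (2 ^ k) powr (\<alpha> - 1)"
          using powr_minus_divide[of "2 ^ k" "\<alpha> - 1"] by simp
        finally show ?thesis using t by (simp add: powr_mult)
      qed
      ultimately show ?thesis using r t q by (simp add: c_def)
    qed
    finally have "c k * measure m (B k) \<le> \<epsilon> * (2 * K) powr p * q ^ k" .
    thus "ennreal (c k) * emeasure m (B k) \<le> ennreal (\<epsilon> * (2 * K) powr p * q ^ k)"
      by (simp add: emeasure_eq_measure ennreal_mult[symmetric] ennreal_leI c_def)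
  qed
  also have "(\<Sum>k. ennreal (\<epsilon> * (2 * K) powr p * q ^ k)) = ennreal (\<epsilon> * (2 * K) powr p * (1 / (1 - q)))"
    using q \<epsilon> by (intro suminf_ennreal_eq sums_mult geometric_sums) auto
  also have "ennreal ?far * emeasure m UNIV + \<dots> = ennreal (?far * measure m UNIV + \<epsilon> * (2 * K) powr p * (1 / (1 - q)))"
    using q \<epsilon> by (simp add: emeasure_eq_measure ennreal_mult[symmetric] ennreal_plus[symmetric] del: ennreal_plus)
  finally have "(\<integral>\<^sup>+y. ennreal (MH \<alpha> x y) \<partial>m) \<le> ennreal (?far * measure m UNIV + \<epsilon> * (2 * K) powr p * (1 / (1 - q)))"
    by (simp add: add_left_mono)
  moreover have "(\<integral>y. MH \<alpha> x y \<partial>m) = enn2real (\<integral>\<^sup>+y. ennreal (MH \<alpha> x y) \<partial>m)"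
    by (intro integral_eq_nn_integral) (auto simp: MH_nonneg)
  ultimately show ?thesis
    using q \<epsilon> by (simp add: q_def enn2real_leI)
qed

text \<open>Fix the density level first, making the near part at most half the tolerance uniformly
  in the cone. This fixes \<open>\<delta>\<close>, after which the far part is a constant times
  \<open>\<bar>snd x\<bar> powr (\<alpha> - 1)\<close> and vanishes in the limit because
  \<open>\<alpha> > 1\<close>.\<close>

lemma nontangential_limit_zero:
  fixes m :: "'a::euclidean_space measure"
  assumes \<alpha>: "\<alpha> > 1" and m: "finite_borel m"
    and dens: "\<forall>\<epsilon>>0. \<exists>\<delta>>0. \<forall>r. 0 < r \<and> r < \<delta> \<longrightarrow> measure m (ball y0 r) \<le> \<epsilon> * r ^ DIM('a)"
  shows "nontangential_limit (\<lambda>x. \<integral>y. MH \<alpha> x y \<partial>m) y0 0"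
  unfolding nontangential_limit_def
proof (intro allI impI order_tendstoI)
  fix \<beta> a :: real assume "a < 0"
  moreover have "0 \<le> (\<integral>y. MH \<alpha> x y \<partial>m)" for x by (simp add: integral_nonneg_AE MH_nonneg)
  ultimately show "\<forall>\<^sub>F x in at (y0, 0) within cone \<beta> (y0, 0). a < (\<integral>y. MH \<alpha> x y \<partial>m)"
    by (intro always_eventually allI) (rule less_le_trans)
next
  fix \<beta> e :: real assume \<beta>: "\<beta> > 0" and e: "e > 0"
  define p where "p = real DIM('a) + \<alpha> - 1"
  define K where "K = (2 + norm y0) * (2 + \<beta>)"
  \<comment> \<open>The factor multiplying the density level in \<open>MH_integral_le\<close>; the
    level \<open>e / (2 * L)\<close> therefore contributes \<open>e / 2\<close>.\<close>
  define L where "L = (2 * K) powr p / (1 - 2 powr (1 - \<alpha>))"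
  have K: "K > 0" using \<beta> by (simp add: K_def add_pos_nonneg)
  hence L: "L > 0" using \<alpha> by (simp add: L_def powr_less_one)
  obtain d where d: "d > 0" "\<And>r. 0 < r \<Longrightarrow> r < d \<Longrightarrow> measure m (ball y0 r) \<le> e / (2 * L) * r ^ DIM('a)"
    using dens e L by (metis divide_pos_pos mult_pos_pos zero_less_numeral)
  \<comment> \<open>Halving \<open>d\<close> turns the strict range \<open>r < d\<close> into the
    closed range \<open>r \<le> \<delta>\<close>; the kernel estimate also asks for
    \<open>\<delta> \<le> 1\<close>.\<close>
  define \<delta> where "\<delta> = min 1 (d / 2)"
  have \<delta>: "0 < \<delta>" "\<delta> \<le> 1" "\<delta> < d" using d by (auto simp: \<delta>_def)
  define D where "D = (K / \<delta>) powr p * measure m UNIV"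
  have "((\<lambda>x. \<bar>snd x\<bar> powr (\<alpha> - 1) * D) \<longlongrightarrow> \<bar>snd (y0, 0::real)\<bar> powr (\<alpha> - 1) * D)
      (at (y0, 0) within cone \<beta> (y0, 0))"
    using \<alpha> by (intro tendsto_intros tendsto_powr') auto
  hence "((\<lambda>x. \<bar>snd x\<bar> powr (\<alpha> - 1) * D) \<longlongrightarrow> 0) (at (y0, 0) within cone \<beta> (y0, 0))"
    by simp
  hence "\<forall>\<^sub>F x in at (y0, 0) within cone \<beta> (y0, 0). \<bar>snd x\<bar> powr (\<alpha> - 1) * D < e / 2"
    using e by (intro order_tendstoD(2)) auto
  moreover have "\<forall>\<^sub>F x in at (y0, 0) within cone \<beta> (y0, 0). x \<in> cone \<beta> (y0, 0)"
    by (auto simp: eventually_at_filter)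
  ultimately show "\<forall>\<^sub>F x in at (y0, 0) within cone \<beta> (y0, 0). (\<integral>y. MH \<alpha> x y \<partial>m) < e"
  proof eventually_elim
    case (elim x)
    have "(\<integral>y. MH \<alpha> x y \<partial>m) \<le> \<bar>snd x\<bar> powr (\<alpha> - 1) * (K / \<delta>) powr p * measure m UNIV
        + e / (2 * L) * (2 * K) powr p / (1 - 2 powr (1 - \<alpha>))"
      unfolding K_def p_def
      by (rule MH_integral_le[OF \<alpha> \<beta> elim(2) \<delta>(1,2) m]) (use d \<delta> e L in auto)
    also have "\<dots> = \<bar>snd x\<bar> powr (\<alpha> - 1) * D + e / (2 * L) * L"
      by (simp only: D_def L_def mult.assoc times_divide_eq_right)
    finally have "(\<integral>y. MH \<alpha> x y \<partial>m) \<le> \<bar>snd x\<bar> powr (\<alpha> - 1) * D + e / (2 * L) * L" .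
    thus ?case using elim(1) L by simp
  qed
qed

lemma AE_nontangential_limit_zero:
  fixes m :: "'a::euclidean_space measure"
  assumes "\<alpha> > 1" "finite_borel m" "A \<in> sets borel" "emeasure m A = 0"
  shows "AE y in lborel. y \<in> A \<longrightarrow> nontangential_limit (\<lambda>x. \<integral>z. MH \<alpha> x z \<partial>m) y 0"
  using AE_density_zero[OF assms(2-4)]
  by eventually_elim (auto intro!: nontangential_limit_zero assms)

subsection \<open>Almost everywhere convergence\<close>

text \<open>An identity between signed measures, rearranged into finite sums of positive measures,
  carries over to integrals. The induction over nonnegative measurable functions involves no
  subtraction.\<close>

lemma sum_nn_integral_cong_sum_emeasure:
  fixes M N :: "'i \<Rightarrow> 'a measure"
  assumes sets: "\<And>i. i \<in> I \<Longrightarrow> sets (M i) = sets S" "\<And>j. j \<in> J \<Longrightarrow> sets (N j) = sets S"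
    and eq: "\<And>A. A \<in> sets S \<Longrightarrow> (\<Sum>i\<in>I. emeasure (M i) A) = (\<Sum>j\<in>J. emeasure (N j) A)"
    and g: "g \<in> borel_measurable S"
  shows "(\<Sum>i\<in>I. \<integral>\<^sup>+x. g x \<partial>M i) = (\<Sum>j\<in>J. \<integral>\<^sup>+x. g x \<partial>N j)"
proof -
  note [simp] = measurable_cong_sets[OF sets(1) refl] measurable_cong_sets[OF sets(2) refl]
    sets sets_eq_imp_space_eq[OF sets(1)] sets_eq_imp_space_eq[OF sets(2)]
  show ?thesis
    using g
  proof induct
    case (cong u v)
    have "(\<integral>\<^sup>+x. u x \<partial>M i) = (\<integral>\<^sup>+x. v x \<partial>M i)" if "i \<in> I" for i
      using cong(3) that by (intro nn_integral_cong) auto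
    moreover have "(\<integral>\<^sup>+x. u x \<partial>N j) = (\<integral>\<^sup>+x. v x \<partial>N j)" if "j \<in> J" for j
      using cong(3) that by (intro nn_integral_cong) auto
    ultimately show ?case using cong(4) by simp
  next
    case (set A)
    thus ?case using eq[of A] by simp
  next
    case (mult u c)
    thus ?case by (simp add: nn_integral_cmult sum_distrib_left[symmetric])
  next
    case (add u v)
    thus ?case by (simp add: nn_integral_add sum.distrib)
  next
    case (seq U)
    have mono: "incseq (\<lambda>n. integral\<^sup>N K (U n))" for K
      using seq by (auto simp: incseq_def le_fun_def intro!: nn_integral_mono)
    have "(\<Sum>i\<in>I. \<integral>\<^sup>+x. (SUP n. U n) x \<partial>M i) = (\<Sum>i\<in>I. SUP n. integral\<^sup>N (M i) (U n))"
      using seq by (intro sum.cong refl) (simp add: nn_integral_monotone_convergence_SUP SUP_apply image_comp)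
    also have "\<dots> = (SUP n. \<Sum>i\<in>I. integral\<^sup>N (M i) (U n))"
      \<comment> \<open>Suprema commute with finite sums here because the integrals increase with
        \<open>n\<close>.\<close>
      by (intro ennreal_SUP_sum[symmetric] mono)
    also have "\<dots> = (SUP n. \<Sum>j\<in>J. integral\<^sup>N (N j) (U n))"
      using seq by simp
    also have "\<dots> = (\<Sum>j\<in>J. SUP n. integral\<^sup>N (N j) (U n))"
      by (intro ennreal_SUP_sum mono)
    also have "\<dots> = (\<Sum>j\<in>J. \<integral>\<^sup>+x. (SUP n. U n) x \<partial>N j)"
      using seq by (intro sum.cong refl) (simp add: nn_integral_monotone_convergence_SUP SUP_apply image_comp)
    finally show ?case .
  qed
qed

section \<open>Integrals against densities with respect to \<open>omega_alpha\<close>\<close>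

lemma space_omega_alpha [simp]: "space (omega_alpha \<alpha>) = UNIV"
  by (simp add: omega_alpha_def)

lemma finite_borel_density:
  assumes "integrable (omega_alpha \<alpha>) g"
  shows "finite_borel (density (omega_alpha \<alpha>) (\<lambda>x. ennreal (g x)))"
proof -
  have [measurable]: "g \<in> borel_measurable borel"
    using borel_measurable_integrable[OF assms] by simp
  have "(\<integral>\<^sup>+x. ennreal (g x) \<partial>omega_alpha \<alpha>) \<le> (\<integral>\<^sup>+x. ennreal (norm (g x)) \<partial>omega_alpha \<alpha>)"
    by (intro nn_integral_mono ennreal_leI) auto
  also have "\<dots> < \<infinity>" using assms by (simp add: integrable_iff_bounded)
  finally show ?thesis
    by (auto simp: finite_borel_def emeasure_density intro!: finite_measureI)
qed

lemma integral_MH_density: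
  assumes "integrable (omega_alpha \<alpha>) g" "\<And>y. g y \<ge> 0"
  shows "(\<integral>y. MH \<alpha> x y \<partial>density (omega_alpha \<alpha>) (\<lambda>y. ennreal (g y))) = (\<integral>y. g y * MH \<alpha> x y \<partial>omega_alpha \<alpha>)"
proof -
  have [measurable]: "g \<in> borel_measurable borel"
    using borel_measurable_integrable[OF assms(1)] by simp
  show ?thesis using assms by (subst integral_density) auto
qed

text \<open>The measure with density \<open>\<bar>g y\<bar>\<close> is finite, so integrability of
  the kernel against finite measures applies to it.\<close>

lemma integrable_mult_MH:
  assumes "\<alpha> > 1" "x \<in> HH" "integrable (omega_alpha \<alpha>) g"
  shows "integrable (omega_alpha \<alpha>) (\<lambda>y. g y * MH \<alpha> x y)"
proof -
  have [measurable]: "g \<in> borel_measurable borel"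
    using borel_measurable_integrable[OF assms(3)] by simp
  have "integrable (density (omega_alpha \<alpha>) (\<lambda>y. ennreal \<bar>g y\<bar>)) (MH \<alpha> x)"
    using assms by (intro integrable_MH finite_borel_density) auto
  hence "integrable (omega_alpha \<alpha>) (\<lambda>y. \<bar>g y\<bar> * MH \<alpha> x y)"
    by (subst (asm) integrable_density) auto
  thus ?thesis
    by (rule Bochner_Integration.integrable_bound) (auto simp: abs_mult)
qed

lemma integral_MH_omega_alpha:
  assumes "\<alpha> > 1" "x \<in> HH"
  shows "(\<integral>y. MH \<alpha> x y \<partial>omega_alpha \<alpha>) = 1"
  using nn_integral_MH_omega_alpha[OF assms]
  by (subst integral_eq_nn_integral) (auto simp: MH_nonneg)

lemma eventually_within_cone_HH: "\<forall>\<^sub>F x in at y within cone \<beta> y. x \<in> HH"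
  by (auto simp: eventually_at_filter cone_def)

text \<open>For rational \<open>q\<close>, the measure \<open>(f - q)\<^sup>+ \<omega>\<close> vanishes on \<open>{f \<le> q}\<close> and
  \<open>(q - f)\<^sup>+ \<omega>\<close> on \<open>{f \<ge> q}\<close>; as the kernel has \<open>\<omega>\<close>-mass one, this squeezes the limit between
  the rationals below and above \<open>f y\<close>.\<close>

lemma AE_nontangential_limit_density:
  fixes f :: "'a::euclidean_space \<Rightarrow> real"
  assumes \<alpha>: "\<alpha> > 1" and f: "integrable (omega_alpha \<alpha>) f"
  shows "AE y in lborel. nontangential_limit (\<lambda>x. \<integral>z. f z * MH \<alpha> x z \<partial>omega_alpha \<alpha>) y (f y)"
proof -
  have [measurable]: "f \<in> borel_measurable borel"
    using borel_measurable_integrable[OF f] by simp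
  interpret prob_space "omega_alpha \<alpha> :: 'a measure" by (rule prob_space_omega_alpha[OF \<alpha>])
  define u where "u q z = max 0 (f z - q)" for q z
  define l where "l q z = max 0 (q - f z)" for q z
  have u: "integrable (omega_alpha \<alpha>) (u q)" and l: "integrable (omega_alpha \<alpha>) (l q)" for q
    unfolding u_def l_def using f by (intro integrable_max Bochner_Integration.integrable_diff; simp)+
  define Pu where "Pu q x = (\<integral>z. u q z * MH \<alpha> x z \<partial>omega_alpha \<alpha>)" for q x
  define Pl where "Pl q x = (\<integral>z. l q z * MH \<alpha> x z \<partial>omega_alpha \<alpha>)" for q x
  have un: "u q z \<ge> 0" and ln: "l q z \<ge> 0" for q z
    by (auto simp: u_def l_def)
  have "AE y in lborel. y \<in> {z. f z \<le> q} \<longrightarrow> nontangential_limit (Pu q) y 0" for q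
  proof -
    have "emeasure (density (omega_alpha \<alpha>) (\<lambda>z. ennreal (u q z))) {z. f z \<le> q} = 0"
      by (subst emeasure_density) (auto simp: u_def nn_integral_0_iff_AE indicator_def)
    from AE_nontangential_limit_zero[OF \<alpha> finite_borel_density[OF u] _ this]
    show ?thesis
      unfolding Pu_def[abs_def] integral_MH_density[OF u un, symmetric] by simp
  qed
  \<comment> \<open>Restricting \<open>q\<close> to the rationals lets one null set serve all levels
    at once.\<close>
  hence 1: "AE y in lborel. \<forall>q\<in>\<rat>. y \<in> {z. f z \<le> q} \<longrightarrow> nontangential_limit (Pu q) y 0"
    by (intro AE_ball_countable') (auto simp: countable_rat)
  have "AE y in lborel. y \<in> {z. f z \<ge> q} \<longrightarrow> nontangential_limit (Pl q) y 0" for q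
  proof -
    have "emeasure (density (omega_alpha \<alpha>) (\<lambda>z. ennreal (l q z))) {z. f z \<ge> q} = 0"
      by (subst emeasure_density) (auto simp: l_def nn_integral_0_iff_AE indicator_def)
    from AE_nontangential_limit_zero[OF \<alpha> finite_borel_density[OF l] _ this]
    show ?thesis
      unfolding Pl_def[abs_def] integral_MH_density[OF l ln, symmetric] by simp
  qed
  hence 2: "AE y in lborel. \<forall>q\<in>\<rat>. y \<in> {z. f z \<ge> q} \<longrightarrow> nontangential_limit (Pl q) y 0"
    by (intro AE_ball_countable') (auto simp: countable_rat)
  have one: "integrable (omega_alpha \<alpha>) (\<lambda>_::'a. q)" for q :: real by simp
  \<comment> \<open>Pointwise \<open>f z \<le> q + u q z\<close>; integrating against the kernel,
    the constant \<open>q\<close> is reproduced because the kernel has mass one. The lower bound is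
    symmetric, with \<open>l q\<close>.\<close>
  have upper: "(\<integral>z. f z * MH \<alpha> x z \<partial>omega_alpha \<alpha>) \<le> q + Pu q x" if x: "x \<in> HH" for q x
  proof -
    have "(\<integral>z. f z * MH \<alpha> x z \<partial>omega_alpha \<alpha>) \<le> (\<integral>z. q * MH \<alpha> x z + u q z * MH \<alpha> x z \<partial>omega_alpha \<alpha>)"
      unfolding distrib_right[symmetric]
      by (intro integral_mono integrable_mult_MH Bochner_Integration.integrable_add mult_right_mono MH_nonneg \<alpha> x f u one)
        (auto simp: u_def)
    also have "\<dots> = q * (\<integral>z. MH \<alpha> x z \<partial>omega_alpha \<alpha>) + Pu q x"
      unfolding Pu_def
      by (simp add: Bochner_Integration.integral_add[OF integrable_mult_MH[OF \<alpha> x one] integrable_mult_MH[OF \<alpha> x u]])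
    finally show ?thesis by (simp add: integral_MH_omega_alpha \<alpha> x)
  qed
  have lower: "q - Pl q x \<le> (\<integral>z. f z * MH \<alpha> x z \<partial>omega_alpha \<alpha>)" if x: "x \<in> HH" for q x
  proof -
    have "(\<integral>z. q * MH \<alpha> x z - l q z * MH \<alpha> x z \<partial>omega_alpha \<alpha>) \<le> (\<integral>z. f z * MH \<alpha> x z \<partial>omega_alpha \<alpha>)"
      unfolding left_diff_distrib[symmetric]
      by (intro integral_mono integrable_mult_MH Bochner_Integration.integrable_diff mult_right_mono MH_nonneg \<alpha> x f l one)
        (auto simp: l_def)
    moreover have "(\<integral>z. q * MH \<alpha> x z - l q z * MH \<alpha> x z \<partial>omega_alpha \<alpha>) = q * (\<integral>z. MH \<alpha> x z \<partial>omega_alpha \<alpha>) - Pl q x"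
      unfolding Pl_def
      by (simp add: Bochner_Integration.integral_diff[OF integrable_mult_MH[OF \<alpha> x one] integrable_mult_MH[OF \<alpha> x l]])
    ultimately show ?thesis by (simp add: integral_MH_omega_alpha \<alpha> x)
  qed
  from 1 2 show ?thesis
  proof eventually_elim
    case (elim y)
    show ?case
      unfolding nontangential_limit_def
    proof (intro allI impI order_tendstoI)
      fix \<beta> a :: real assume \<beta>: "\<beta> > 0" and "a < f y"
      \<comment> \<open>Since \<open>q < f y\<close>, the error \<open>Pl q\<close> tends to 0 at
        \<open>y\<close>, and the gap \<open>q - a\<close> absorbs it.\<close>
      then obtain q where q: "q \<in> \<rat>" "a < q" "q < f y" using Rats_dense_in_real by blast
      hence "nontangential_limit (Pl q) y 0" using elim(2) by auto
      hence "(Pl q \<longlongrightarrow> 0) (at (y, 0) within cone \<beta> (y, 0))"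
        using \<beta> by (simp add: nontangential_limit_def)
      hence "\<forall>\<^sub>F x in at (y, 0) within cone \<beta> (y, 0). Pl q x < q - a"
        using q by (intro order_tendstoD(2)) auto
      with eventually_within_cone_HH[of "(y, 0)" \<beta>]
      show "\<forall>\<^sub>F x in at (y, 0) within cone \<beta> (y, 0). a < (\<integral>z. f z * MH \<alpha> x z \<partial>omega_alpha \<alpha>)"
      proof eventually_elim
        case (elim x)
        thus ?case using lower[of x q] by linarith
      qed
    next
      fix \<beta> a :: real assume \<beta>: "\<beta> > 0" and "f y < a"
      then obtain q where q: "q \<in> \<rat>" "f y < q" "q < a" using Rats_dense_in_real by blast
      hence "nontangential_limit (Pu q) y 0" using elim(1) by auto
      hence "(Pu q \<longlongrightarrow> 0) (at (y, 0) within cone \<beta> (y, 0))"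
        using \<beta> by (simp add: nontangential_limit_def)
      hence "\<forall>\<^sub>F x in at (y, 0) within cone \<beta> (y, 0). Pu q x < a - q"
        using q by (intro order_tendstoD(2)) auto
      with eventually_within_cone_HH[of "(y, 0)" \<beta>]
      show "\<forall>\<^sub>F x in at (y, 0) within cone \<beta> (y, 0). (\<integral>z. f z * MH \<alpha> x z \<partial>omega_alpha \<alpha>) < a"
      proof eventually_elim
        case (elim x)
        thus ?case using upper[of x q] by linarith
      qed
    qed
  qed
qed

text \<open>The identity \<open>decomp\<close> concerns differences of measures of sets. Splitting
  \<open>f\<close> into positive and negative parts and moving every subtracted term across yields
  two equal sums of finite positive measures. Kernel integrals against these agree and are finite,
  so the differences can be restored.\<close>

lemma MH_meas_decomposition:
  fixes x :: "'a::euclidean_space \<times> real"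
  assumes \<alpha>: "\<alpha> > 1" and x: "x \<in> HH"
    and fin: "finite_borel \<mu>p" "finite_borel \<mu>n" "finite_borel \<nu>p" "finite_borel \<nu>n"
    and f: "integrable (omega_alpha \<alpha>) f"
    and decomp: "\<forall>A \<in> sets borel. measure \<mu>p A - measure \<mu>n A
                    = (LINT x:A|omega_alpha \<alpha>. f x) + measure \<nu>p A - measure \<nu>n A"
  shows "MH_meas \<alpha> \<mu>p \<mu>n x = (\<integral>z. f z * MH \<alpha> x z \<partial>omega_alpha \<alpha>)
    + (\<integral>z. MH \<alpha> x z \<partial>\<nu>p) - (\<integral>z. MH \<alpha> x z \<partial>\<nu>n)"
proof -
  have [measurable]: "f \<in> borel_measurable borel"
    using borel_measurable_integrable[OF f] by simp
  define fp where "fp z = max 0 (f z)" for z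
  define fn where "fn z = max 0 (- f z)" for z
  have ff: "f z = fp z - fn z" for z by (simp add: fp_def fn_def)
  have nn: "fp z \<ge> 0" "fn z \<ge> 0" for z by (auto simp: fp_def fn_def)
  have fp: "integrable (omega_alpha \<alpha>) fp" and fn: "integrable (omega_alpha \<alpha>) fn"
    unfolding fp_def fn_def using f by auto
  have [measurable]: "fp \<in> borel_measurable borel" "fn \<in> borel_measurable borel"
    unfolding fp_def fn_def by measurable
  define Fp where "Fp = density (omega_alpha \<alpha>) (\<lambda>z. ennreal (fp z))"
  define Fn where "Fn = density (omega_alpha \<alpha>) (\<lambda>z. ennreal (fn z))"
  have finF: "finite_borel Fp" "finite_borel Fn"
    unfolding Fp_def Fn_def by (intro finite_borel_density fp fn)+
  have measure_density: "measure (density (omega_alpha \<alpha>) (\<lambda>z. ennreal (g z))) A = (\<integral>z. indicator A z * g z \<partial>omega_alpha \<alpha>)"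
    if g: "integrable (omega_alpha \<alpha>) g" "\<And>z. g z \<ge> 0" and A: "A \<in> sets borel" for g A
  proof -
    have [measurable]: "g \<in> borel_measurable borel"
      using borel_measurable_integrable[OF g(1)] by simp
    show ?thesis unfolding measure_def using g A
      by (subst emeasure_density, simp, simp, subst integral_eq_nn_integral)
        (auto intro!: arg_cong[where f = enn2real] nn_integral_cong simp: indicator_def)
  qed
  have int_A: "(LINT x:A|omega_alpha \<alpha>. f x) = measure Fp A - measure Fn A" if A: "A \<in> sets borel" for A
  proof -
    have "integrable (omega_alpha \<alpha>) (\<lambda>z. indicator A z * fp z)" "integrable (omega_alpha \<alpha>) (\<lambda>z. indicator A z * fn z)"
      using integrable_mult_indicator[of A, OF _ fp] integrable_mult_indicator[of A, OF _ fn] A by simp_all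
    thus ?thesis unfolding Fp_def Fn_def set_lebesgue_integral_def
      by (simp add: measure_density fp fn nn A ff right_diff_distrib)
  qed
  \<comment> \<open>\<open>M\<close> lists the measures standing on the left after the rearrangement
    and \<open>N\<close> those on the right.\<close>
  define M where "M i = (if i = 0 then \<mu>p else if i = 1 then \<nu>n else Fn)" for i :: nat
  define N where "N i = (if i = 0 then \<mu>n else if i = 1 then \<nu>p else Fp)" for i :: nat
  have finMN: "finite_borel (M i)" "finite_borel (N i)" for i
    using fin finF by (auto simp: M_def N_def)
  have sum3: "(\<Sum>i\<in>{0,1,2::nat}. h i) = h 0 + h 1 + h 2" for h :: "nat \<Rightarrow> 'b::comm_monoid_add"
    by (simp add: add.assoc)
  have em: "emeasure m A = ennreal (measure m A)" if "finite_borel m" for m :: "'a measure" and A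
    using that by (simp add: finite_borel_def finite_measure.emeasure_eq_measure)
  have nn_int: "(\<integral>\<^sup>+z. ennreal (MH \<alpha> x z) \<partial>m) = ennreal (\<integral>z. MH \<alpha> x z \<partial>m)" if "finite_borel m" for m
    using that by (intro nn_integral_eq_integral integrable_MH \<alpha> x) (auto simp: MH_nonneg)
  have P0: "(\<integral>z. MH \<alpha> x z \<partial>m) \<ge> 0" for m
    by (simp add: integral_nonneg_AE MH_nonneg)
  have "(\<Sum>i\<in>{0,1,2}. \<integral>\<^sup>+z. ennreal (MH \<alpha> x z) \<partial>M i) = (\<Sum>i\<in>{0,1,2}. \<integral>\<^sup>+z. ennreal (MH \<alpha> x z) \<partial>N i)"
  proof (rule sum_nn_integral_cong_sum_emeasure[where S = borel])
    fix A :: "'a set" assume A: "A \<in> sets borel"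
    hence "measure \<mu>p A + measure \<nu>n A + measure Fn A = measure \<mu>n A + measure \<nu>p A + measure Fp A"
      using decomp int_A[OF A] by fastforce
    hence "(\<Sum>i\<in>{0,1,2}. measure (M i) A) = (\<Sum>i\<in>{0,1,2}. measure (N i) A)"
      unfolding sum3 by (simp add: M_def N_def)
    thus "(\<Sum>i\<in>{0,1,2}. emeasure (M i) A) = (\<Sum>i\<in>{0,1,2}. emeasure (N i) A)"
      unfolding em[OF finMN(1)] em[OF finMN(2)] by (subst (1 2) sum_ennreal) auto
  qed (use finMN in \<open>auto simp: finite_borel_def\<close>)
  hence "(\<Sum>i\<in>{0,1,2}. \<integral>z. MH \<alpha> x z \<partial>M i) = (\<Sum>i\<in>{0,1,2}. \<integral>z. MH \<alpha> x z \<partial>N i)"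
    unfolding nn_int[OF finMN(1)] nn_int[OF finMN(2)]
    by (simp only: sum_ennreal[OF P0] ennreal_inj[OF sum_nonneg[OF P0] sum_nonneg[OF P0]])
  hence "(\<integral>z. MH \<alpha> x z \<partial>\<mu>p) + (\<integral>z. MH \<alpha> x z \<partial>\<nu>n) + (\<integral>z. MH \<alpha> x z \<partial>Fn)
      = (\<integral>z. MH \<alpha> x z \<partial>\<mu>n) + (\<integral>z. MH \<alpha> x z \<partial>\<nu>p) + (\<integral>z. MH \<alpha> x z \<partial>Fp)"
    unfolding sum3 by (simp add: M_def N_def)
  moreover have "(\<integral>z. f z * MH \<alpha> x z \<partial>omega_alpha \<alpha>) = (\<integral>z. MH \<alpha> x z \<partial>Fp) - (\<integral>z. MH \<alpha> x z \<partial>Fn)"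
    unfolding Fp_def Fn_def ff left_diff_distrib
    by (simp add: integral_MH_density fp fn nn integrable_mult_MH \<alpha> x)
  ultimately show ?thesis unfolding MH_meas_def by simp
qed

text \<open>The density of \<open>omega_alpha\<close> is strictly positive everywhere, so its null
  sets are Lebesgue null.\<close>

lemma AE_notin_null_omega_alpha:
  fixes N :: "'a::euclidean_space set"
  assumes "\<alpha> > 1" "N \<in> sets borel" "emeasure (omega_alpha \<alpha>) N = 0"
  shows "AE y in lborel. y \<notin> N"
proof -
  let ?w = "\<lambda>y::'a. C3 TYPE('a) \<alpha> * norm (ed - (y, 0)) powr (- (dimd TYPE('a) + \<alpha> - 2))"
  have [measurable]: "?w \<in> borel_measurable borel" unfolding norm_diff_boundary by measurable
  have pos: "?w y > 0" for y
    using assms by (auto simp: C3_def dimd_def ed_def zero_prod_def intro!: mult_pos_pos divide_pos_pos Gamma_real_pos)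
  have "(\<integral>\<^sup>+y. ennreal (?w y) * indicator N y \<partial>lborel) = 0"
    using assms by (simp add: omega_alpha_def emeasure_density)
  hence "AE y in lborel. ennreal (?w y) * indicator N y = 0"
    using assms by (subst (asm) nn_integral_0_iff_AE) auto
  thus ?thesis
  proof eventually_elim
    case (elim y)
    thus ?case using pos[of y] by (auto simp: indicator_def)
  qed
qed

theorem theorem4p18:
  fixes \<alpha> :: real
    and \<mu>p \<mu>n \<nu>p \<nu>n :: "'a::euclidean_space measure"
    and f :: "'a \<Rightarrow> real"
  assumes alpha: "1 < \<alpha>" "\<alpha> < 2"
    and mu: "finite_borel \<mu>p" "finite_borel \<mu>n"
    and nu: "finite_borel \<nu>p" "finite_borel \<nu>n"
    and f_int: "f \<in> borel_measurable borel" "integrable (omega_alpha \<alpha>) f"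
    and sing: "\<exists>N \<in> sets borel. emeasure (omega_alpha \<alpha>) N = 0
                  \<and> emeasure \<nu>p (UNIV - N) = 0 \<and> emeasure \<nu>n (UNIV - N) = 0"
    and decomp: "\<forall>A \<in> sets borel. measure \<mu>p A - measure \<mu>n A
                    = (LINT x:A|omega_alpha \<alpha>. f x) + measure \<nu>p A - measure \<nu>n A"
  shows "AE yb in lborel. nontangential_limit (MH_meas \<alpha> \<mu>p \<mu>n) yb (f yb)"
proof -
  obtain N where N: "N \<in> sets borel" "emeasure (omega_alpha \<alpha>) N = 0"
      "emeasure \<nu>p (UNIV - N) = 0" "emeasure \<nu>n (UNIV - N) = 0"
    using sing by blast
  have c: "UNIV - N \<in> sets borel" using N(1) by auto
  \<comment> \<open>Almost every \<open>y\<close> lies outside \<open>N\<close>, and there both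
    singular parts have nontangential limit 0, since each vanishes on the complement of
    \<open>N\<close>.\<close>
  note ae = AE_nontangential_limit_density[OF alpha(1) f_int(2)] AE_notin_null_omega_alpha[OF alpha(1) N(1,2)]
    AE_nontangential_limit_zero[OF alpha(1) nu(1) c N(3)] AE_nontangential_limit_zero[OF alpha(1) nu(2) c N(4)]
  from ae show ?thesis
  proof eventually_elim
    case (elim y)
    show ?case
      unfolding nontangential_limit_def
    proof (intro allI impI)
      fix \<beta> :: real assume \<beta>: "\<beta> > 0"
      let ?F = "at (y, 0) within cone \<beta> (y, 0)"
      have "((\<lambda>x. (\<integral>z. f z * MH \<alpha> x z \<partial>omega_alpha \<alpha>) + (\<integral>z. MH \<alpha> x z \<partial>\<nu>p) - (\<integral>z. MH \<alpha> x z \<partial>\<nu>n))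
          \<longlongrightarrow> f y + 0 - 0) ?F"
        using elim \<beta> by (intro tendsto_intros) (auto simp: nontangential_limit_def)
      \<comment> \<open>The decomposition of the kernel integral holds off the boundary, and every
        point of the cone lies there.\<close>
      moreover have "\<forall>\<^sub>F x in ?F. (\<integral>z. f z * MH \<alpha> x z \<partial>omega_alpha \<alpha>) + (\<integral>z. MH \<alpha> x z \<partial>\<nu>p)
          - (\<integral>z. MH \<alpha> x z \<partial>\<nu>n) = MH_meas \<alpha> \<mu>p \<mu>n x"
        using eventually_within_cone_HH[of "(y, 0)" \<beta>]
        by eventually_elim (simp add: MH_meas_decomposition[OF alpha(1) _ mu nu f_int(2) decomp])
      ultimately show "(MH_meas \<alpha> \<mu>p \<mu>n \<longlongrightarrow> f y) ?F"
        by (simp add: tendsto_cong)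
    qed
  qed
qed

end
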